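(* Let $U_1=\begin{pmatrix}1&-1\\-1&1\end{pmatrix}$ and $U_2=-U_1$. Let $\rho$ be any symmetric state with zero discord on $\mathbb{C}^2\otimes\mathbb{C}^2$, i.e. $\rho=\sum_{i,j=0}^{1}p(i,j)|\psi_i\rangle\langle\psi_i|\otimes|\psi_j\rangle\langle\psi_j|$ with $\{|\psi_0\rangle,|\psi_1\rangle\}$ an orthonormal basis of $\mathbb{C}^2$ and $[p(i,j)]$ a symmetric entrywise nonnegative matrix with $\sum_{i,j}p(i,j)=1$. Suppose that measuring $\rho$ gives a classical correlated equilibrium of the game $(U_1,U_2)$. Then there is no quantum advantage: Player 1 (who is quantum) does not have any advantage on $\rho$, whichever of the payoff matrices $U_1,U_2$ she has.
   Context: $\{|0\rangle,|1\rangle\}$ is the computational basis of $\mathbb{C}^2$; matrices are indexed by $\{0,1\}$. Correlated equilibrium of $(U_1,U_2)$: a probability distribution $q$ on $\{0,1\}^2$ such that $\sum_j q(i,j)U_1(i,j)\ge\sum_j q(i,j)U_1(i',j)$ for all $i,i'$ and $\sum_i q(i,j)U_2(i,j)\ge\sum_i q(i,j)U_2(i,j')$ for all $j,j'$. "Measuring $\rho$ gives a classical correlated equilibrium" means that $q(a,b)=\langle ab|\rho|ab\rangle$ is a correlated equilibrium. Quantum advantage: Player 1 holds the first system of $\rho$, and Player 2 (classical) holds the second and measures it in the computational basis. Player 1 may apply any quantum operation (completely positive trace-preserving map) $\Phi$ to her system and then measures in the computational basis. If she has payoff matrix $U\in\{U_1,U_2\}$, her expected payoff is $\sum_{a,b}U(a,b)\,\langle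 ab|(\Phi\otimes\mathrm{id})(\rho)|ab\rangle$, and $QA_U(\rho)$ is the maximum of this quantity over all $\Phi$. Player 1 "does not have any advantage" if $QA_U(\rho)= 0$, where $0$ is the expected payoff at equilibrium. *)

theory Defs
  imports "HOL-Analysis.Analysis"
begin

text \<open>
  The index type \<^typ>\<open>2\<close> of the qubit has exactly the elements \<open>0\<close> and \<open>1\<close> (with \<open>2 = 0\<close>), so
  row and column \<open>0\<close>, \<open>1\<close> below are those of the computational basis.

  An operator on \<open>\<complex>\<^sup>2 \<otimes> \<complex>\<^sup>k\<close> is its function of matrix entries \<open>X (i, k) (j, l)\<close>, with a free index
  type for the second factor: \<^typ>\<open>2\<close> for the second qubit, and \<^typ>\<open>nat\<close>, restricted to \<open>{..<n}\<close>,
  for the ancilla \<open>\<complex>\<^sup>n\<close> with variable \<open>n\<close> in the definition of complete positivity.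
\<close>

type_synonym qubit_op = "complex ^ 2 ^ 2"
type_synonym 'k joint_op = "2 \<times> 'k \<Rightarrow> 2 \<times> 'k \<Rightarrow> complex"

definition cscale :: "complex \<Rightarrow> qubit_op \<Rightarrow> qubit_op"
  where "cscale c A = (\<chi> i j. c * A $ i $ j)"

definition ketbra :: "complex ^ 2 \<Rightarrow> qubit_op"
  where "ketbra v = (\<chi> i j. v $ i * cnj (v $ j))"

definition tensor_op :: "qubit_op \<Rightarrow> qubit_op \<Rightarrow> 2 joint_op"
  where "tensor_op A B = (\<lambda>(i, k) (j, l). A $ i $ j * B $ k $ l)"

text \<open>In dimension two, two orthonormal vectors automatically form a basis. The library inner product
  on \<^typ>\<open>complex ^ 2\<close> is the real one, hence the explicit Hermitian form.\<close>

definition orthonormal_basis :: "(2 \<Rightarrow> complex ^ 2) \<Rightarrow> bool"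
  where "orthonormal_basis \<psi> \<longleftrightarrow>
    (\<forall>i j. (\<Sum>k\<in>UNIV. cnj (\<psi> i $ k) * \<psi> j $ k) = (if i = j then 1 else 0))"

definition psd_on :: "'i set \<Rightarrow> ('i \<Rightarrow> 'i \<Rightarrow> complex) \<Rightarrow> bool"
  where "psd_on S X \<longleftrightarrow>
    (\<forall>v. (\<Sum>x\<in>S. \<Sum>y\<in>S. cnj (v x) * X x y * v y) \<in> \<real>\<^sub>\<ge>\<^sub>0)"

text \<open>\<open>(\<Phi> \<otimes> id) X\<close>: the map \<open>\<Phi>\<close> acts on each block of \<open>X\<close> with the second indices fixed.\<close>

definition tensor_id :: "(qubit_op \<Rightarrow> qubit_op) \<Rightarrow> 'k joint_op \<Rightarrow> 'k joint_op"
  where "tensor_id \<Phi> X = (\<lambda>(a, k) (b, l). \<Phi> (\<chi> i j. X (i, k) (j, l)) $ a $ b)"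

definition linear_op_map :: "(qubit_op \<Rightarrow> qubit_op) \<Rightarrow> bool"
  where "linear_op_map \<Phi> \<longleftrightarrow>
    (\<forall>A B. \<Phi> (A + B) = \<Phi> A + \<Phi> B) \<and> (\<forall>c A. \<Phi> (cscale c A) = cscale c (\<Phi> A))"

definition completely_positive :: "(qubit_op \<Rightarrow> qubit_op) \<Rightarrow> bool"
  where "completely_positive \<Phi> \<longleftrightarrow>
    (\<forall>(n::nat) X. psd_on (UNIV \<times> {..<n}) X \<longrightarrow> psd_on (UNIV \<times> {..<n}) (tensor_id \<Phi> X))"

definition quantum_operation :: "(qubit_op \<Rightarrow> qubit_op) \<Rightarrow> bool"
  where "quantum_operation \<Phi> \<longleftrightarrow>
    linear_op_map \<Phi> \<and> completely_positive \<Phi> \<and> (\<forall>A. trace (\<Phi> A) = trace A)"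

definition symmetric_zero_discord :: "2 joint_op \<Rightarrow> bool"
  where "symmetric_zero_discord \<rho> \<longleftrightarrow>
    (\<exists>(\<psi> :: 2 \<Rightarrow> complex ^ 2) (p :: real ^ 2 ^ 2).
      orthonormal_basis \<psi> \<and>
      transpose p = p \<and> (\<forall>i j. 0 \<le> p $ i $ j) \<and> (\<Sum>i\<in>UNIV. \<Sum>j\<in>UNIV. p $ i $ j) = 1 \<and>
      \<rho> = (\<lambda>x y. \<Sum>i\<in>UNIV. \<Sum>j\<in>UNIV.
        complex_of_real (p $ i $ j) * tensor_op (ketbra (\<psi> i)) (ketbra (\<psi> j)) x y))"

text \<open>The diagonal entries of a state are real, so taking the real part loses nothing.\<close>

definition measurement :: "2 joint_op \<Rightarrow> real ^ 2 ^ 2"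
  where "measurement \<rho> = (\<chi> a b. Re (\<rho> (a, b) (a, b)))"

definition correlated_equilibrium :: "real ^ 2 ^ 2 \<Rightarrow> real ^ 2 ^ 2 \<Rightarrow> real ^ 2 ^ 2 \<Rightarrow> bool"
  where "correlated_equilibrium U V q \<longleftrightarrow>
    (\<forall>i j. 0 \<le> q $ i $ j) \<and> (\<Sum>i\<in>UNIV. \<Sum>j\<in>UNIV. q $ i $ j) = 1 \<and>
    (\<forall>i i'. (\<Sum>j\<in>UNIV. q $ i $ j * U $ i $ j) \<ge> (\<Sum>j\<in>UNIV. q $ i $ j * U $ i' $ j)) \<and>
    (\<forall>j j'. (\<Sum>i\<in>UNIV. q $ i $ j * V $ i $ j) \<ge> (\<Sum>i\<in>UNIV. q $ i $ j * V $ i $ j'))"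

definition expected_payoff :: "real ^ 2 ^ 2 \<Rightarrow> 2 joint_op \<Rightarrow> (qubit_op \<Rightarrow> qubit_op) \<Rightarrow> real"
  where "expected_payoff U \<rho> \<Phi> =
    (\<Sum>a\<in>UNIV. \<Sum>b\<in>UNIV. U $ a $ b * measurement (tensor_id \<Phi> \<rho>) $ a $ b)"

text \<open>\<open>m\<close> is the maximum, in particular attained, of the expected payoff over all operations. As a
  relation, this includes the existence of the maximum.\<close>

definition is_quantum_advantage :: "real ^ 2 ^ 2 \<Rightarrow> 2 joint_op \<Rightarrow> real \<Rightarrow> bool"
  where "is_quantum_advantage U \<rho> m \<longleftrightarrow>
    (\<exists>\<Phi>. quantum_operation \<Phi> \<and> expected_payoff U \<rho> \<Phi> = m) \<and>
    (\<forall>\<Phi>. quantum_operation \<Phi> \<longrightarrow> expected_payoff U \<rho> \<Phi> \<le> m)"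

definition no_quantum_advantage :: "real ^ 2 ^ 2 \<Rightarrow> 2 joint_op \<Rightarrow> bool"
  where "no_quantum_advantage U \<rho> \<longleftrightarrow> is_quantum_advantage U \<rho> 0"

definition U1 :: "real ^ 2 ^ 2"
  where "U1 = (\<chi> i j. if i = j then 1 else - 1)"

definition U2 :: "real ^ 2 ^ 2"
  where "U2 = - U1"

end

theory Submission
  imports Defs
begin

text \<open>
  The only correlated equilibrium of this game is the uniform distribution. Write \<open>D\<close> for the doubly
  stochastic matrix \<open>|\<langle>a|\<psi>\<^sub>k\<rangle>|\<^sup>2\<close> and \<open>2c - 1\<close> for its determinant. Conditioned on Player 2's outcome \<open>b\<close>,
  Player 1's unnormalised state is \<open>\<sigma>\<^sub>b = \<Sum>\<^sub>k (p D\<^sup>T)(k,b) |\<psi>\<^sub>k\<rangle>\<langle>\<psi>\<^sub>k|\<close>. Uniformity of \<open>D p D\<^sup>T\<close> says that \<open>D\<close>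
  kills the difference of the two columns of \<open>p D\<^sup>T\<close>, and this difference is itself a multiple of
  \<open>2c - 1\<close>. Hence it vanishes whether or not \<open>D\<close> is invertible, so \<open>\<sigma>\<^sub>0 = \<sigma>\<^sub>1\<close>, and every operation of
  Player 1 earns exactly \<open>0\<close>.
\<close>

text \<open>\<open>exhaust_2\<close> lists the elements as \<open>1\<close> and \<open>2\<close>;
  since \<open>0\<close> differs from \<open>1\<close>, it must be \<open>2\<close>.\<close>

lemma forall_bit: "(\<forall>i::2. P i) \<longleftrightarrow> P 0 \<and> P 1"
  by (metis exhaust_2 zero_neq_one)

lemma sum_bit: "(\<Sum>i\<in>(UNIV::2 set). f i) = f 0 + f 1"
proof -
  have "(UNIV :: 2 set) = {0, 1}"
    using forall_bit[of "\<lambda>i. i \<in> {0, 1}"] by (simp add: set_eq_iff)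
  then have "sum f UNIV = sum f {0, 1}"
    by (rule arg_cong)
  then show ?thesis by simp
qed

text \<open>Doing nothing serves as the operation at which the maximal payoff is attained.\<close>

lemma quantum_operation_id: "quantum_operation (\<lambda>A. A)"
proof -
  have "tensor_id (\<lambda>A. A) X = X" for X :: "nat joint_op"
    by (auto simp: tensor_id_def fun_eq_iff)
  then show ?thesis
    by (simp add: quantum_operation_def linear_op_map_def completely_positive_def)
qed

text \<open>The four incentive constraints form a cycle of inequalities through all four entries,
  which are therefore equal.\<close>

lemma correlated_equilibrium_uniform:
  assumes "correlated_equilibrium U1 U2 q"
  shows "q $ a $ b = 1 / 4"
proof -
  have player1: "(\<Sum>j\<in>UNIV. q $ i $ j * U1 $ i' $ j) \<le> (\<Sum>j\<in>UNIV. q $ i $ j * U1 $ i $ j)"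
    and player2: "(\<Sum>i\<in>UNIV. q $ i $ j * U2 $ i $ j') \<le> (\<Sum>i\<in>UNIV. q $ i $ j * U2 $ i $ j)"
    for i i' j j'
    using assms unfolding correlated_equilibrium_def by blast+
  have "q $ 0 $ 1 \<le> q $ 0 $ 0" "q $ 1 $ 0 \<le> q $ 1 $ 1"
    using player1[of 0 1] player1[of 1 0] by (simp_all add: U1_def sum_bit)
  moreover have "q $ 0 $ 0 \<le> q $ 1 $ 0" "q $ 1 $ 1 \<le> q $ 0 $ 1"
    using player2[of 0 1] player2[of 1 0] by (simp_all add: U1_def U2_def sum_bit)
  moreover have "q $ 0 $ 0 + q $ 0 $ 1 + (q $ 1 $ 0 + q $ 1 $ 1) = 1"
    using assms by (simp add: correlated_equilibrium_def sum_bit)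
  ultimately have "\<forall>a b. q $ a $ b = 1 / 4"
    unfolding forall_bit by linarith
  then show ?thesis by blast
qed

definition born_weight :: "(2 \<Rightarrow> complex ^ 2) \<Rightarrow> 2 \<Rightarrow> 2 \<Rightarrow> real"
  where "born_weight \<psi> a k = (cmod (\<psi> k $ a))\<^sup>2"

lemma of_real_born_weight: "complex_of_real (born_weight \<psi> a k) = \<psi> k $ a * cnj (\<psi> k $ a)"
  by (simp only: born_weight_def complex_norm_square)

lemma born_weight_column_sum:
  assumes "orthonormal_basis \<psi>"
  shows "(\<Sum>a\<in>UNIV. born_weight \<psi> a k) = 1"
proof -
  have "complex_of_real (\<Sum>a\<in>UNIV. born_weight \<psi> a k) = 1"
    using assms by (simp add: orthonormal_basis_def of_real_born_weight mult.commute)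
  then show ?thesis
    using of_real_eq_1_iff by blast
qed

text \<open>Orthonormality makes \<open>M\<close> a left inverse of the square matrix
  \<open>N\<close>, hence also a right inverse, so the rows of \<open>N\<close> are normalised
  too.\<close>

lemma born_weight_row_sum:
  assumes "orthonormal_basis \<psi>"
  shows "(\<Sum>k\<in>UNIV. born_weight \<psi> a k) = 1"
proof -
  define M N :: qubit_op where "M = (\<chi> i k. cnj (\<psi> i $ k))" and "N = (\<chi> k j. \<psi> j $ k)"
  have "M ** N = mat 1"
    using assms
    by (simp add: orthonormal_basis_def M_def N_def matrix_matrix_mult_def mat_def vec_eq_iff)
  then have "N ** M = mat 1"
    by (simp only: matrix_left_right_inverse)
  then have "(N ** M) $ a $ a = 1"
    by (simp add: mat_def)
  then have "complex_of_real (\<Sum>k\<in>UNIV. born_weight \<psi> a k) = 1"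
    by (simp add: of_real_born_weight M_def N_def matrix_matrix_mult_def)
  then show ?thesis
    using of_real_eq_1_iff by blast
qed

lemma uniform_measurement_imp_equal_weights:
  fixes D p :: "2 \<Rightarrow> 2 \<Rightarrow> real"
  assumes rows: "\<And>a. (\<Sum>k\<in>UNIV. D a k) = 1"
    and columns: "\<And>k. (\<Sum>a\<in>UNIV. D a k) = 1"
    and uniform: "\<And>a. (\<Sum>k\<in>UNIV. D a k * (\<Sum>l\<in>UNIV. p k l * D 0 l))
                    = (\<Sum>k\<in>UNIV. D a k * (\<Sum>l\<in>UNIV. p k l * D 1 l))"
  shows "(\<Sum>l\<in>UNIV. p k l * D 0 l) = (\<Sum>l\<in>UNIV. p k l * D 1 l)"
proof -
  define c t where "c = D 0 0" and "t k = (2 * c - 1) * (p k 0 - p k 1)" for k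
  have D: "D 0 0 = c" "D 0 1 = 1 - c" "D 1 0 = 1 - c" "D 1 1 = c"
    using rows[of 0] columns[of 0] columns[of 1] by (simp_all add: sum_bit c_def)
  have diff: "(\<Sum>l\<in>UNIV. p k l * D 0 l) - (\<Sum>l\<in>UNIV. p k l * D 1 l) = t k" for k
    by (simp add: sum_bit D t_def algebra_simps)
  have "D a 0 * t 0 + D a 1 * t 1 = 0" for a
    using uniform[of a] by (simp add: sum_bit algebra_simps flip: diff)
  from this[of 0] this[of 1] have eqs: "c * t 0 + (1 - c) * t 1 = 0" "(1 - c) * t 0 + c * t 1 = 0"
    by (simp_all add: D)
  \<comment> \<open>Adding the two equations eliminates \<open>c\<close>.\<close>
  then have t1: "t 1 = - t 0"
    by (simp add: algebra_simps)
  then have "(2 * c - 1) * t 0 = 0"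
    using eqs(1) by (simp add: algebra_simps)
  with t1 have "\<forall>k. (2 * c - 1) * t k = 0"
    by (simp add: forall_bit)
  \<comment> \<open>By definition of \<open>t\<close> this is a square
    \<open>(2 * c - 1)\<^sup>2\<close> times \<open>p k 0 - p k 1\<close>; whichever factor
    vanishes, so does \<open>t k\<close>.\<close>
  then have "t k = 0"
    by (auto simp: t_def)
  then show ?thesis
    using diff[of k] by simp
qed

lemma zero_discord_equal_conditional_states:
  assumes "symmetric_zero_discord \<rho>"
    and uniform: "\<And>a b. measurement \<rho> $ a $ b = 1 / 4"
  shows "\<rho> (i, 0) (j, 0) = \<rho> (i, 1) (j, 1)"
proof -
  obtain \<psi> and p :: "real ^ 2 ^ 2" where \<psi>: "orthonormal_basis \<psi>"
    and \<rho>: "\<rho> = (\<lambda>x y. \<Sum>i\<in>UNIV. \<Sum>j\<in>UNIV.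
        complex_of_real (p $ i $ j) * tensor_op (ketbra (\<psi> i)) (ketbra (\<psi> j)) x y)"
    using assms(1) unfolding symmetric_zero_discord_def by blast
  let ?D = "born_weight \<psi>"
  \<comment> \<open>Diagonal entries of the second factor are Born weights, so fixing outcome
    \<open>b\<close> leaves the conditional state of Player 1, a mixture of the projectors onto
    \<open>\<psi> k\<close>.\<close>
  have block: "\<rho> (i, b) (j, b) =
      (\<Sum>k\<in>UNIV. complex_of_real (\<Sum>l\<in>UNIV. p $ k $ l * ?D b l) * (\<psi> k $ i * cnj (\<psi> k $ j)))"
    for i j b
    by (simp add: \<rho> tensor_op_def ketbra_def of_real_born_weight sum_bit algebra_simps)
  have "measurement \<rho> $ a $ b = (\<Sum>k\<in>UNIV. ?D a k * (\<Sum>l\<in>UNIV. p $ k $ l * ?D b l))" for a b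
    by (simp only: measurement_def vec_lambda_beta block of_real_born_weight[symmetric]
        of_real_mult[symmetric] of_real_sum[symmetric] Re_complex_of_real mult.commute)
  then have "(\<Sum>k\<in>UNIV. ?D a k * (\<Sum>l\<in>UNIV. p $ k $ l * ?D b l)) = 1 / 4" for a b
    by (metis uniform)
  then have "(\<Sum>l\<in>UNIV. p $ k $ l * ?D 0 l) = (\<Sum>l\<in>UNIV. p $ k $ l * ?D 1 l)" for k
    using \<psi> by (intro uniform_measurement_imp_equal_weights[where p = "\<lambda>k l. p $ k $ l" and D = ?D])
      (simp_all only: born_weight_row_sum born_weight_column_sum)
  then show ?thesis
    by (simp only: block)
qed

text \<open>\<open>tensor_id\<close> acts block by block, so equal blocks stay equal; each row of
  \<open>U\<close> sums to zero, so the terms of the two outcomes of Player 2 cancel.\<close>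

lemma expected_payoff_eq_0:
  assumes "\<And>i j. \<rho> (i, 0) (j, 0) = \<rho> (i, 1) (j, 1)" and "U \<in> {U1, U2}"
  shows "expected_payoff U \<rho> \<Phi> = 0"
  using assms
  by (auto simp: expected_payoff_def measurement_def tensor_id_def sum_bit U1_def U2_def)

theorem corollary5:
  fixes \<rho> :: "2 joint_op"
  assumes "symmetric_zero_discord \<rho>"
    and "correlated_equilibrium U1 U2 (measurement \<rho>)"
  shows "\<forall>U\<in>{U1, U2}. no_quantum_advantage U \<rho>"
proof
  fix U assume "U \<in> {U1, U2}"
  moreover have "\<rho> (i, 0) (j, 0) = \<rho> (i, 1) (j, 1)" for i j
    using assms by (intro zero_discord_equal_conditional_states correlated_equilibrium_uniform)
  ultimately have "expected_payoff U \<rho> \<Phi> = 0" for \<Phi>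
    by (intro expected_payoff_eq_0)
  then show "no_quantum_advantage U \<rho>"
    using quantum_operation_id by (auto simp: no_quantum_advantage_def is_quantum_advantage_def)
qed

end
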